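(* (1) Extended phase space integrators with symmetric projection (based on a composition method $\Psi_h$ as in the context) preserve arbitrary affine symmetries, quadratic first integrals, and constant symplectic structures when there are any: for every smooth $H$ and step $z_0\mapsto z_1$ of the integrator, (i) if $Q(z)=z^\top Cz$ is a first integral of $X_H$ then $Q(z_1)=Q(z_0)$; (ii) the step map is symplectic with respect to $dq\wedge dp$; (iii) if $a(z)=Az+b$ is an affine map of $\mathbb{R}^{2d}$ with $X_H(Az+b)=AX_H(z)$ for all $z$, then the step map commutes with $a$. (2) Monoimplicit symplectic Runge--Kutta methods of all orders exist: for every positive integer $p$ there is a Runge--Kutta method of classical order at least $p$ whose coefficient matrix $(a_{ij})$ is a rank-one matrix plus a matrix of spectral radius zero and whose coefficients satisfy $b_ib_j-b_ia_{ij}-b_ja_{ji}=0$ for all $i,j$.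
   Context: Let $H\colon\mathbb{R}^{2d}\to\mathbb{R}$ be smooth and $X_H$ the vector field $\dot q=D_2H(q,p)$, $\dot p=-D_1H(q,p)$. On $\mathbb{R}^{4d}\ni(q,x,p,y)$ let $\hat H_A(q,x,p,y)=H(x,p)$, $\hat H_B(q,x,p,y)=H(q,y)$, with flows $\exp(tX_{\hat H_A})(q,x,p,y)=(q+tD_2H(x,p),x,p,y-tD_1H(x,p))$ and $\exp(tX_{\hat H_B})(q,x,p,y)=(q,x+tD_2H(q,y),p-tD_1H(q,y),y)$. A composition method with real coefficients $a_1,\dots,a_s$ is $\Psi_h=\phi_s\circ\cdots\circ\phi_1$ with $\phi_i=\exp(a_ihX_{\hat H_A})$ for odd $i$ and $\phi_i=\exp(a_ihX_{\hat H_B})$ for even $i$. Let $D=\begin{bmatrix}I_d&-I_d&0&0\\0&0&I_d&-I_d\end{bmatrix}$ and $\mathcal{N}=\ker D=\{(q,q,p,p)\}$. The extended phase space integrator with symmetric projection maps $z_0=(q_0,p_0)$ to $z_1$: $\zeta_0=(q_0,q_0,p_0,p_0)$; find $\mu\in\mathbb{R}^{2d}$ with $\Psi_h(\zeta_0+D^\top\mu)+D^\top\mu\in\mathcal{N}$; set $(q_1,q_1,p_1,p_1):=\Psi_h(\zeta_0+D^\top\mu)+D^\top\mu$ and $z_1=(q_1,p_1)$. A Runge--Kutta method is $Z_i=z_0+h\sum_ja_{ij}f(Z_j)$, $z_1=z_0+h\sum_ib_if(Z_i)$. *)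

theory Defs
  imports "HOL-Analysis.Analysis"
begin

definition qpart :: "real^('d::finite+'d) \<Rightarrow> real^('d::finite)" where
  "qpart z = (\<chi> i. z $ Inl i)"

definition ppart :: "real^('d::finite+'d) \<Rightarrow> real^('d::finite)" where
  "ppart z = (\<chi> i. z $ Inr i)"

definition mkz :: "real^('d::finite) \<Rightarrow> real^('d::finite) \<Rightarrow> real^('d::finite+'d)" where
  "mkz q p = (\<chi> k. case k of Inl i \<Rightarrow> q $ i | Inr i \<Rightarrow> p $ i)"

text \<open>Smoothness (C-infinity): all iterated Frechet derivatives exist everywhere.
  Df y vs is the iterated derivative at y applied to the directions vs.\<close>
definition smooth_fun :: "('a::real_normed_vector \<Rightarrow> 'b::real_normed_vector) \<Rightarrow> bool" where
  "smooth_fun f \<longleftrightarrow> (\<exists>Df :: 'a \<Rightarrow> 'a list \<Rightarrow> 'b.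
      (\<forall>y. Df y [] = f y) \<and>
      (\<forall>y vs. ((\<lambda>x. Df x vs) has_derivative (\<lambda>v. Df y (v # vs))) (at y)))"

definition D1H :: "(real^('d::finite+'d) \<Rightarrow> real) \<Rightarrow> real^('d::finite+'d) \<Rightarrow> real^('d::finite)" where
  "D1H H z = (\<chi> i. frechet_derivative H (at z) (mkz (axis i 1) 0))"

definition D2H :: "(real^('d::finite+'d) \<Rightarrow> real) \<Rightarrow> real^('d::finite+'d) \<Rightarrow> real^('d::finite)" where
  "D2H H z = (\<chi> i. frechet_derivative H (at z) (mkz 0 (axis i 1)))"

definition XH :: "(real^('d::finite+'d) \<Rightarrow> real) \<Rightarrow> real^('d::finite+'d) \<Rightarrow> real^('d::finite+'d)" where
  "XH H z = mkz (D2H H z) (- D1H H z)"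

definition first_integral :: "(real^('d::finite+'d) \<Rightarrow> real) \<Rightarrow> (real^('d::finite+'d) \<Rightarrow> real) \<Rightarrow> bool" where
  "first_integral H Q \<longleftrightarrow> (\<forall>z. \<exists>Q'. (Q has_derivative Q') (at z) \<and> Q' (XH H z) = 0)"

definition omega :: "real^('d::finite+'d) \<Rightarrow> real^('d::finite+'d) \<Rightarrow> real" where
  "omega u v = qpart u \<bullet> ppart v - ppart u \<bullet> qpart v"

type_synonym 'd ext = "(real^'d) \<times> (real^'d) \<times> (real^'d) \<times> (real^'d)"

definition addE :: "('d::finite) ext \<Rightarrow> ('d::finite) ext \<Rightarrow> ('d::finite) ext" where
  "addE u v = (case u of (q,x,p,y) \<Rightarrow> case v of (q',x',p',y') \<Rightarrow> (q+q', x+x', p+p', y+y'))"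

definition flowA :: "(real^('d::finite+'d) \<Rightarrow> real) \<Rightarrow> real \<Rightarrow> ('d::finite) ext \<Rightarrow> ('d::finite) ext" where
  "flowA H t w = (case w of (q,x,p,y) \<Rightarrow>
     (q + t *\<^sub>R D2H H (mkz x p), x, p, y - t *\<^sub>R D1H H (mkz x p)))"

definition flowB :: "(real^('d::finite+'d) \<Rightarrow> real) \<Rightarrow> real \<Rightarrow> ('d::finite) ext \<Rightarrow> ('d::finite) ext" where
  "flowB H t w = (case w of (q,x,p,y) \<Rightarrow>
     (q, x + t *\<^sub>R D2H H (mkz q y), p - t *\<^sub>R D1H H (mkz q y), y))"

text \<open>Composition method Psi_h = phi_s o ... o phi_1 with coefficients as = [a_1,...,a_s];
  phi_i uses flow A for odd i and flow B for even i (1-based), i.e. even/odd 0-based index.\<close>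
definition psi :: "(real^('d::finite+'d) \<Rightarrow> real) \<Rightarrow> real list \<Rightarrow> real \<Rightarrow> ('d::finite) ext \<Rightarrow> ('d::finite) ext" where
  "psi H as h w = fold (\<lambda>(i,c) u. if even i then flowA H (c * h) u else flowB H (c * h) u)
                       (zip [0..<length as] as) w"

definition DT :: "real^('d::finite+'d) \<Rightarrow> ('d::finite) ext" where
  "DT \<mu> = (qpart \<mu>, - qpart \<mu>, ppart \<mu>, - ppart \<mu>)"

definition embed :: "real^('d::finite+'d) \<Rightarrow> ('d::finite) ext" where
  "embed z = (qpart z, qpart z, ppart z, ppart z)"

definition inN :: "('d::finite) ext \<Rightarrow> bool" where
  "inN w \<longleftrightarrow> (case w of (q,x,p,y) \<Rightarrow> q = x \<and> p = y)"

definition projE :: "('d::finite) ext \<Rightarrow> real^('d::finite+'d)" where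
  "projE w = (case w of (q,x,p,y) \<Rightarrow> mkz q p)"

definition step_res :: "(real^('d::finite+'d) \<Rightarrow> real) \<Rightarrow> real list \<Rightarrow> real \<Rightarrow> real^('d::finite+'d) \<Rightarrow> real^('d::finite+'d) \<Rightarrow> ('d::finite) ext" where
  "step_res H as h z \<mu> = addE (psi H as h (addE (embed z) (DT \<mu>))) (DT \<mu>)"

definition is_step :: "(real^('d::finite+'d) \<Rightarrow> real) \<Rightarrow> real list \<Rightarrow> real \<Rightarrow> real^('d::finite+'d) \<Rightarrow> real^('d::finite+'d) \<Rightarrow> bool" where
  "is_step H as h z0 z1 \<longleftrightarrow> (\<exists>\<mu>. step_res H as h z0 \<mu> = embed z1)"

datatype rtree = Node "rtree list"

fun tord :: "rtree \<Rightarrow> nat" where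
  "tord (Node ts) = 1 + sum_list (map tord ts)"

fun tgamma :: "rtree \<Rightarrow> nat" where
  "tgamma (Node ts) = tord (Node ts) * prod_list (map tgamma ts)"

fun ew :: "nat \<Rightarrow> (nat \<Rightarrow> nat \<Rightarrow> real) \<Rightarrow> rtree \<Rightarrow> nat \<Rightarrow> real" where
  "ew s A (Node ts) i = prod_list (map (\<lambda>t. \<Sum>j<s. A i j * ew s A t j) ts)"

text \<open>Classical order at least p (Butcher order conditions for all rooted trees with at most p vertices).\<close>
definition rk_order_ge :: "nat \<Rightarrow> (nat \<Rightarrow> nat \<Rightarrow> real) \<Rightarrow> (nat \<Rightarrow> real) \<Rightarrow> nat \<Rightarrow> bool" where
  "rk_order_ge s A b p \<longleftrightarrow>
     (\<forall>t. tord t \<le> p \<longrightarrow> (\<Sum>i<s. b i * ew s A t i) = 1 / real (tgamma t))"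

definition spectral_radius_zero :: "nat \<Rightarrow> (nat \<Rightarrow> nat \<Rightarrow> real) \<Rightarrow> bool" where
  "spectral_radius_zero s N \<longleftrightarrow>
     (\<forall>ev::complex. (\<exists>v::nat \<Rightarrow> complex. (\<exists>i<s. v i \<noteq> 0) \<and>
         (\<forall>i<s. (\<Sum>j<s. complex_of_real (N i j) * v j) = ev * v i)) \<longrightarrow> ev = 0)"

definition rank_one :: "nat \<Rightarrow> (nat \<Rightarrow> nat \<Rightarrow> real) \<Rightarrow> bool" where
  "rank_one s R \<longleftrightarrow> (\<exists>u v :: nat \<Rightarrow> real. (\<exists>i<s. u i \<noteq> 0) \<and> (\<exists>j<s. v j \<noteq> 0) \<and>
       (\<forall>i<s. \<forall>j<s. R i j = u i * v j))"

end

theory Submission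
  imports Defs "HOL-Computational_Algebra.Polynomial"
begin

text \<open>
  (1) Split an extended point \<open>(q, x, p, y)\<close> into two phase points \<open>zA = (x, p)\<close> and
  \<open>zB = (q, y)\<close>. Every stage of \<open>\<Psi>\<^sub>h\<close> moves one copy along \<open>X\<^sub>H\<close> evaluated at the
  other. Hence a stage preserves the polarised form \<open>zA\<^sup>T C zB + zB\<^sup>T C zA\<close> when
  \<open>z\<^sup>T C z\<close> is a first integral, commutes with an affine symmetry acting on both copies, and
  is symplectic for \<open>dq \<and> dp + dx \<and> dy\<close>, because \<open>DX\<^sub>H\<close> is skew for \<open>\<omega>\<close> (symmetry of
  second derivatives). The symmetric projection adds the multiplier \<open>\<sigma>\<close> to one copy and
  subtracts it from the other, before and after \<open>\<Psi>\<^sub>h\<close> with the roles exchanged. In all three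
  structures the \<open>\<sigma>\<close>-terms are then the same at both ends and cancel.

  (2) Take the Gauss collocation method with \<open>s = p\<close> stages: \<open>a\<^sub>i\<^sub>j\<close> and \<open>b\<^sub>j\<close> are the
  integrals of the Lagrange basis polynomial \<open>\<ell>\<^sub>j\<close> over \<open>[0, c\<^sub>i]\<close> and \<open>[0, 1]\<close>, the nodes
  \<open>c\<^sub>i\<close> being the roots of the Legendre polynomial. Interpolation gives the simplifying
  assumption \<open>C(s)\<close>, Gauss quadrature gives \<open>B(2s)\<close>, and together they give order \<open>s\<close>. Exactness of the quadrature for
  \<open>(\<integral>\<ell>\<^sub>i \<integral>\<ell>\<^sub>j)'\<close> is the symplecticity condition. The \<open>x\<^sup>s\<close>-coefficient \<open>v\<^sub>j\<close> of
  \<open>\<integral>\<ell>\<^sub>j\<close> splits off the rank-one part \<open>c\<^sub>i\<^sup>s v\<^sub>j\<close>. The rest represents, on polynomials of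
  degree \<open>< s\<close>, integration with the \<open>x\<^sup>s\<close>-term dropped; this strictly raises the order of
  vanishing at \<open>0\<close> and so is nilpotent.
\<close>

lemma qpart_mkz [simp]: "qpart (mkz q p) = q"
  by (simp add: qpart_def mkz_def vec_eq_iff)

lemma ppart_mkz [simp]: "ppart (mkz q p) = p"
  by (simp add: ppart_def mkz_def vec_eq_iff)

lemma phase_eq_iff: "z = z' \<longleftrightarrow> qpart z = qpart z' \<and> ppart z = ppart z'"
proof
  assume "qpart z = qpart z' \<and> ppart z = ppart z'"
  then have "z $ k = z' $ k" for k
    by (cases k) (auto simp: qpart_def ppart_def vec_eq_iff)
  then show "z = z'"
    by (simp add: vec_eq_iff)
qed simp

lemma qpart_ppart_linear [simp]:
  "qpart (a + b) = qpart a + qpart b" "ppart (a + b) = ppart a + ppart b"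
  "qpart (a - b) = qpart a - qpart b" "ppart (a - b) = ppart a - ppart b"
  "qpart (- a) = - qpart a" "ppart (- a) = - ppart a"
  "qpart (r *\<^sub>R a) = r *\<^sub>R qpart a" "ppart (r *\<^sub>R a) = r *\<^sub>R ppart a"
  "qpart 0 = 0" "ppart 0 = 0"
  by (simp_all add: qpart_def ppart_def vec_eq_iff)

lemma bounded_linear_qpart: "bounded_linear qpart"
  by (simp add: linear_conv_bounded_linear[symmetric] linearI)

lemma bounded_linear_ppart: "bounded_linear ppart"
  by (simp add: linear_conv_bounded_linear[symmetric] linearI)

lemma inner_qpart_ppart: "u \<bullet> v = qpart u \<bullet> qpart v + ppart u \<bullet> ppart v"
proof -
  have "u \<bullet> v = (\<Sum>k\<in>range Inl \<union> range Inr. u $ k * v $ k)"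
    by (simp add: inner_vec_def UNIV_sum[symmetric])
  also have "\<dots> = (\<Sum>k\<in>range Inl. u $ k * v $ k) + (\<Sum>k\<in>range Inr. u $ k * v $ k)"
    by (rule sum.union_disjoint) auto
  also have "\<dots> = qpart u \<bullet> qpart v + ppart u \<bullet> ppart v"
    by (simp add: sum.reindex inner_vec_def qpart_def ppart_def)
  finally show ?thesis .
qed

lemma omega_bilinear:
  "omega (a + b) c = omega a c + omega b c" "omega a (b + c) = omega a b + omega a c"
  "omega (a - b) c = omega a c - omega b c" "omega a (b - c) = omega a b - omega a c"
  "omega (- a) c = - omega a c" "omega a (- c) = - omega a c"
  "omega (r *\<^sub>R a) c = r * omega a c" "omega a (r *\<^sub>R c) = r * omega a c"
  by (simp_all add: omega_def algebra_simps)

text \<open>\<open>XH H z = symp_J (\<nabla>H z)\<close>.\<close>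

definition symp_J :: "real^('d::finite+'d) \<Rightarrow> real^('d+'d)" where
  "symp_J v = mkz (ppart v) (- qpart v)"

lemma omega_eq_inner_symp_J: "omega u v = u \<bullet> symp_J v"
  by (simp add: omega_def symp_J_def inner_qpart_ppart)

lemma symp_J_inner: "symp_J u \<bullet> symp_J v = u \<bullet> v"
  by (simp add: symp_J_def inner_qpart_ppart add.commute)

lemma symp_J_symp_J: "symp_J (symp_J v) = - v"
  by (simp add: symp_J_def phase_eq_iff)

lemma linear_symp_J: "linear symp_J"
  by (rule linearI) (simp_all add: symp_J_def phase_eq_iff)

lemma mkz_axis: "mkz (axis i 1) 0 = axis (Inl i) 1" "mkz 0 (axis i 1) = axis (Inr i) 1"
  by (auto simp: mkz_def axis_def vec_eq_iff split: sum.split)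

section \<open>Hamiltonian vector fields are infinitesimally symplectic\<close>

lemma has_real_derivative_along_line:
  fixes F :: "'a::real_normed_vector \<Rightarrow> real"
  assumes "\<And>y. (F has_derivative F' y) (at y)"
  shows "((\<lambda>s. F (a + s *\<^sub>R u)) has_real_derivative F' (a + s *\<^sub>R u) u) (at s)"
proof -
  have "((\<lambda>s. F (a + s *\<^sub>R u)) has_derivative (\<lambda>r. F' (a + s *\<^sub>R u) (r *\<^sub>R u))) (at s)"
    by (rule has_derivative_compose[OF _ assms]) (auto intro!: derivative_eq_intros)
  moreover have "F' (a + s *\<^sub>R u) (r *\<^sub>R u) = F' (a + s *\<^sub>R u) u * r" for r
    using linear_cmul[OF has_derivative_linear[OF assms]] by simp
  ultimately show ?thesis
    by (simp add: has_field_derivative_def mult_commute_abs)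
qed

text \<open>Two applications of the mean value theorem express the second difference of \<open>H\<close>
  through one value of the second derivative \<open>H''\<close> near \<open>z\<close>.\<close>

lemma second_difference_mvt:
  fixes H :: "'a::real_normed_vector \<Rightarrow> real"
  assumes H': "\<And>y. (H has_derivative H' y) (at y)"
    and H'': "\<And>y u. ((\<lambda>x. H' x u) has_derivative (\<lambda>w. H'' y w u)) (at y)"
    and "0 < h"
  obtains p where "norm (p - z) \<le> h * (norm u + norm v)"
    "H (z + h *\<^sub>R u + h *\<^sub>R v) - H (z + h *\<^sub>R u) - H (z + h *\<^sub>R v) + H z = h * h * H'' p v u"
proof -
  define \<alpha> where "\<alpha> s = H ((z + h *\<^sub>R v) + s *\<^sub>R u) - H (z + s *\<^sub>R u)" for s
  have "(\<alpha> has_real_derivative (H' ((z + h *\<^sub>R v) + s *\<^sub>R u) u - H' (z + s *\<^sub>R u) u)) (at s)" for s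
    unfolding \<alpha>_def by (intro DERIV_diff has_real_derivative_along_line H')
  then obtain \<xi> where \<xi>: "0 < \<xi>" "\<xi> < h"
    "\<alpha> h - \<alpha> 0 = h * (H' ((z + h *\<^sub>R v) + \<xi> *\<^sub>R u) u - H' (z + \<xi> *\<^sub>R u) u)"
    using MVT2[OF \<open>0 < h\<close>, of \<alpha> "\<lambda>s. H' ((z + h *\<^sub>R v) + s *\<^sub>R u) u - H' (z + s *\<^sub>R u) u"] by auto
  define \<beta> where "\<beta> t = H' ((z + \<xi> *\<^sub>R u) + t *\<^sub>R v) u" for t
  have "(\<beta> has_real_derivative H'' ((z + \<xi> *\<^sub>R u) + t *\<^sub>R v) v u) (at t)" for t
    unfolding \<beta>_def by (rule has_real_derivative_along_line[OF H''])
  then obtain \<eta> where \<eta>: "0 < \<eta>" "\<eta> < h" "\<beta> h - \<beta> 0 = h * H'' ((z + \<xi> *\<^sub>R u) + \<eta> *\<^sub>R v) v u"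
    using MVT2[OF \<open>0 < h\<close>, of \<beta> "\<lambda>t. H'' ((z + \<xi> *\<^sub>R u) + t *\<^sub>R v) v u"] by auto
  define p where "p = (z + \<xi> *\<^sub>R u) + \<eta> *\<^sub>R v"
  have "\<beta> h - \<beta> 0 = H' ((z + h *\<^sub>R v) + \<xi> *\<^sub>R u) u - H' (z + \<xi> *\<^sub>R u) u"
    by (simp add: \<beta>_def algebra_simps)
  then have "\<alpha> h - \<alpha> 0 = h * h * H'' p v u"
    using \<xi>(3) \<eta>(3) by (simp add: p_def)
  then have "H (z + h *\<^sub>R u + h *\<^sub>R v) - H (z + h *\<^sub>R u) - H (z + h *\<^sub>R v) + H z = h * h * H'' p v u"
    by (simp add: \<alpha>_def algebra_simps)
  moreover have "norm (p - z) \<le> h * (norm u + norm v)"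
  proof -
    have "norm (p - z) \<le> \<xi> * norm u + \<eta> * norm v"
      using norm_triangle_ineq[of "\<xi> *\<^sub>R u" "\<eta> *\<^sub>R v"] \<xi> \<eta> by (simp add: p_def)
    also have "\<dots> \<le> h * norm u + h * norm v"
      using \<xi> \<eta> by (intro add_mono mult_right_mono) auto
    finally show ?thesis
      by (simp add: algebra_simps)
  qed
  ultimately show ?thesis
    using that by blast
qed

lemma second_derivative_swap_nearby:
  fixes H :: "'a::real_normed_vector \<Rightarrow> real"
  assumes H': "\<And>y. (H has_derivative H' y) (at y)"
    and H'': "\<And>y u. ((\<lambda>x. H' x u) has_derivative (\<lambda>w. H'' y w u)) (at y)"
    and "0 < \<delta>"
  obtains p p' where "dist p z < \<delta>" "dist p' z < \<delta>" "H'' p v u = H'' p' u v"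
proof -
  define K where "K = norm u + norm v + 1"
  define h where "h = \<delta> / (2 * K)"
  have "0 < K"
    by (simp add: K_def add_nonneg_pos)
  then have "0 < h"
    using \<open>0 < \<delta>\<close> by (simp add: h_def)
  have close: "dist x z < \<delta>" if "norm (x - z) \<le> h * (norm u + norm v)" for x
  proof -
    have "h * (norm u + norm v) < h * K"
      using \<open>0 < h\<close> by (simp add: K_def)
    also have "\<dots> < \<delta>"
      using \<open>0 < K\<close> \<open>0 < \<delta>\<close> by (simp add: h_def)
    finally show ?thesis
      using that by (simp add: dist_norm)
  qed
  obtain p where p: "norm (p - z) \<le> h * (norm u + norm v)"
    "H (z + h *\<^sub>R u + h *\<^sub>R v) - H (z + h *\<^sub>R u) - H (z + h *\<^sub>R v) + H z = h * h * H'' p v u"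
    using second_difference_mvt[OF H' H'' \<open>0 < h\<close>] by blast
  obtain p' where p': "norm (p' - z) \<le> h * (norm v + norm u)"
    "H (z + h *\<^sub>R v + h *\<^sub>R u) - H (z + h *\<^sub>R v) - H (z + h *\<^sub>R u) + H z = h * h * H'' p' u v"
    using second_difference_mvt[OF H' H'' \<open>0 < h\<close>] by blast
  have swap: "z + h *\<^sub>R v + h *\<^sub>R u = z + h *\<^sub>R u + h *\<^sub>R v"
    by (simp add: add_ac)
  have "h * h * H'' p v u = h * h * H'' p' u v"
    using p(2) p'(2)[unfolded swap] by linarith
  then have "H'' p v u = H'' p' u v"
    using \<open>0 < h\<close> by simp
  moreover have "dist p z < \<delta>" "dist p' z < \<delta>"
    using close p(1) p'(1) by (simp_all add: add.commute)
  ultimately show ?thesis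
    using that by blast
qed

lemma second_derivative_symmetric:
  fixes H :: "'a::real_normed_vector \<Rightarrow> real"
  assumes H': "\<And>y. (H has_derivative H' y) (at y)"
    and H'': "\<And>y u. ((\<lambda>x. H' x u) has_derivative (\<lambda>w. H'' y w u)) (at y)"
    and cont: "\<And>u v. continuous (at z) (\<lambda>x. H'' x u v)"
  shows "H'' z u v = H'' z v u"
proof (rule ccontr)
  assume "H'' z u v \<noteq> H'' z v u"
  define e where "e = \<bar>H'' z v u - H'' z u v\<bar> / 2"
  have "0 < e"
    using \<open>H'' z u v \<noteq> H'' z v u\<close> by (simp add: e_def)
  obtain d1 where "0 < d1" and d1: "\<And>x. dist x z < d1 \<Longrightarrow> \<bar>H'' x v u - H'' z v u\<bar> < e"
    using cont[of v u] \<open>0 < e\<close> unfolding continuous_at_eps_delta dist_real_def by blast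
  obtain d2 where "0 < d2" and d2: "\<And>x. dist x z < d2 \<Longrightarrow> \<bar>H'' x u v - H'' z u v\<bar> < e"
    using cont[of u v] \<open>0 < e\<close> unfolding continuous_at_eps_delta dist_real_def by blast
  obtain p p' where p: "dist p z < min d1 d2" and p': "dist p' z < min d1 d2"
    and swap: "H'' p v u = H'' p' u v"
    using second_derivative_swap_nearby[OF H' H''] \<open>0 < d1\<close> \<open>0 < d2\<close> by (metis min_less_iff_conj)
  have "\<bar>H'' p v u - H'' z v u\<bar> < e"
    using d1 p by simp
  moreover have "\<bar>H'' p' u v - H'' z u v\<bar> < e"
    using d2 p' by simp
  moreover have "\<bar>H'' z v u - H'' z u v\<bar> \<le> \<bar>H'' p v u - H'' z v u\<bar> + \<bar>H'' p' u v - H'' z u v\<bar>"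
    using swap abs_triangle_ineq[of "H'' z v u - H'' p v u" "H'' p' u v - H'' z u v"]
    by (simp add: abs_minus_commute)
  ultimately  have "\<bar>H'' z v u - H'' z u v\<bar> < 2 * e"
    by linarith
  then show False
    by (simp add: e_def)
qed

lemma has_derivative_vec_lambda:
  fixes f :: "'a::real_normed_vector \<Rightarrow> 'n::finite \<Rightarrow> real"
  assumes "\<And>k. ((\<lambda>x. f x k) has_derivative (\<lambda>v. f' v k)) (at z)"
  shows "((\<lambda>x. \<chi> k. f x k) has_derivative (\<lambda>v. \<chi> k. f' v k)) (at z)"
proof -
  have "((\<lambda>x. (\<chi> k. f x k) \<bullet> i) has_derivative (\<lambda>v. (\<chi> k. f' v k) \<bullet> i)) (at z)"
    if "i \<in> Basis" for i :: "real^'n"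
    using that assms by (auto simp: Basis_vec_def inner_axis)
  then show ?thesis
    using has_derivative_componentwise_within[where S = UNIV] by blast
qed

lemma smooth_fun_second_derivative:
  fixes H :: "'a::real_normed_vector \<Rightarrow> real"
  assumes "smooth_fun H"
  obtains H' H'' where "\<And>y. (H has_derivative H' y) (at y)"
    and "\<And>y v. ((\<lambda>x. H' x v) has_derivative (\<lambda>u. H'' y u v)) (at y)"
    and "\<And>y u v. H'' y u v = H'' y v u"
proof -
  obtain Df :: "'a \<Rightarrow> 'a list \<Rightarrow> real"
    where Df0: "\<And>y. Df y [] = H y"
      and Df: "\<And>y vs. ((\<lambda>x. Df x vs) has_derivative (\<lambda>v. Df y (v # vs))) (at y)"
    using assms unfolding smooth_fun_def by blast
  have H': "(H has_derivative (\<lambda>v. Df y [v])) (at y)" for y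
    using Df[where y = y and vs = "[]"] by (simp add: Df0)
  have "Df y [u, v] = Df y [v, u]" for y u v
    using Df by (intro second_derivative_symmetric[where H = H and H' = "\<lambda>y u. Df y [u]"] H')
      (auto intro: has_derivative_continuous)
  with H' Df show ?thesis
    by (rule that)
qed

lemma XH_derivative_skew:
  assumes "smooth_fun H"
  obtains DX where "\<And>z. (XH H has_derivative DX z) (at z)"
    and "\<And>z a b. omega (DX z a) b + omega a (DX z b) = 0"
proof -
  obtain H' H'' where H': "\<And>y. (H has_derivative H' y) (at y)"
    and H'': "\<And>y v. ((\<lambda>x. H' x v) has_derivative (\<lambda>u. H'' y u v)) (at y)"
    and sym: "\<And>y u v. H'' y u v = H'' y v u"
    using smooth_fun_second_derivative[OF assms] by blast
  define grad where "grad x = (\<chi> k. H' x (axis k 1))" for x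
  define G where "G z a = (\<chi> k. H'' z a (axis k 1))" for z a
  have "frechet_derivative H (at z) = H' z" for z
    using frechet_derivative_at[OF H'] by simp
  then have "XH H = (\<lambda>x. symp_J (grad x))"
    by (simp add: fun_eq_iff XH_def symp_J_def D1H_def D2H_def grad_def mkz_axis phase_eq_iff
        qpart_def ppart_def)
  moreover have "(grad has_derivative G z) (at z)" for z
    unfolding grad_def G_def by (rule has_derivative_vec_lambda) (rule H'')
  ultimately have dX: "(XH H has_derivative (\<lambda>a. symp_J (G z a))) (at z)" for z
    using linear_symp_J by (auto intro: bounded_linear.has_derivative simp: linear_conv_bounded_linear)
  have "u \<bullet> G z a = H'' z u a" for z u a
  proof -
    have lin: "linear (\<lambda>w. H'' z w a)"
      using has_derivative_linear[OF H''] .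
    have "u \<bullet> G z a = (\<Sum>k\<in>UNIV. u $ k * H'' z (axis k 1) a)"
      by (simp add: G_def inner_vec_def sym[of z a])
    also have "\<dots> = H'' z (\<Sum>k\<in>UNIV. u $ k *\<^sub>R axis k 1) a"
      by (simp add: linear_sum[OF lin] linear_cmul[OF lin])
    also have "\<dots> = H'' z u a"
      using basis_expansion[of u] by (simp add: scalar_mult_eq_scaleR)
    finally show ?thesis .
  qed
  then have "omega (symp_J (G z a)) b + omega a (symp_J (G z b)) = 0" for z a b
    by (simp add: omega_eq_inner_symp_J symp_J_inner symp_J_symp_J inner_commute sym)
  with dX show ?thesis
    by (rule that)
qed

definition zA :: "'d::finite ext \<Rightarrow> real^('d+'d)" where
  "zA w = (case w of (q, x, p, y) \<Rightarrow> mkz x p)"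

definition zB :: "'d::finite ext \<Rightarrow> real^('d+'d)" where
  "zB w = (case w of (q, x, p, y) \<Rightarrow> mkz q y)"

definition ext_of :: "real^('d::finite+'d) \<Rightarrow> real^('d+'d) \<Rightarrow> 'd ext" where
  "ext_of a b = (qpart b, qpart a, ppart a, ppart b)"

lemma zA_ext_of [simp]: "zA (ext_of a b) = a"
  by (simp add: zA_def ext_of_def phase_eq_iff)

lemma zB_ext_of [simp]: "zB (ext_of a b) = b"
  by (simp add: zB_def ext_of_def phase_eq_iff)

lemma ext_of_zA_zB: "ext_of (zA w) (zB w) = w"
  by (cases w) (simp add: zA_def zB_def ext_of_def)

lemma ext_eq_iff: "w = w' \<longleftrightarrow> zA w = zA w' \<and> zB w = zB w'"
  by (metis ext_of_zA_zB)

lemma zA_zB_linear [simp]: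
  "zA (u + v) = zA u + zA v" "zB (u + v) = zB u + zB v"
  "zA (r *\<^sub>R u) = r *\<^sub>R zA u" "zB (r *\<^sub>R u) = r *\<^sub>R zB u"
  by (cases u; cases v; simp add: zA_def zB_def phase_eq_iff)+

lemma bounded_linear_zA: "bounded_linear zA"
  by (simp add: linear_conv_bounded_linear[symmetric] linearI)

lemma bounded_linear_zB: "bounded_linear zB"
  by (simp add: linear_conv_bounded_linear[symmetric] linearI)

lemma has_derivative_ext_of:
  assumes "(f has_derivative f') (at x)" "(g has_derivative g') (at x)"
  shows "((\<lambda>w. ext_of (f w) (g w)) has_derivative (\<lambda>d. ext_of (f' d) (g' d))) (at x)"
  unfolding ext_of_def using assms
  by (intro has_derivative_Pair bounded_linear.has_derivative[OF bounded_linear_qpart]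
      bounded_linear.has_derivative[OF bounded_linear_ppart])

lemma zA_flowA [simp]: "zA (flowA H t w) = zA w"
  by (cases w) (simp add: flowA_def zA_def)

lemma zB_flowA [simp]: "zB (flowA H t w) = zB w + t *\<^sub>R XH H (zA w)"
  by (cases w) (simp add: flowA_def zA_def zB_def XH_def phase_eq_iff)

lemma zA_flowB [simp]: "zA (flowB H t w) = zA w + t *\<^sub>R XH H (zB w)"
  by (cases w) (simp add: flowB_def zA_def zB_def XH_def phase_eq_iff)

lemma zB_flowB [simp]: "zB (flowB H t w) = zB w"
  by (cases w) (simp add: flowB_def zB_def)

lemma zA_embed [simp]: "zA (embed z) = z"
  by (simp add: embed_def zA_def phase_eq_iff)

lemma zB_embed [simp]: "zB (embed z) = z"
  by (simp add: embed_def zB_def phase_eq_iff)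

lemma zB_DT [simp]: "zB (DT \<mu>) = - zA (DT \<mu>)"
  by (simp add: DT_def zA_def zB_def phase_eq_iff)

lemma zA_DT: "zA (DT \<mu>) = mkz (- qpart \<mu>) (ppart \<mu>)"
  by (simp add: DT_def zA_def)

lemma bounded_linear_DT: "bounded_linear DT"
  by (simp add: linear_conv_bounded_linear[symmetric] linearI ext_eq_iff zA_DT phase_eq_iff)

lemma bounded_linear_embed: "bounded_linear embed"
  by (simp add: linear_conv_bounded_linear[symmetric] linearI ext_eq_iff)

lemma inN_iff: "inN w \<longleftrightarrow> zA w = zB w"
  by (cases w) (auto simp: inN_def zA_def zB_def phase_eq_iff)

lemma projE_inN: "inN w \<Longrightarrow> projE w = zA w"
  by (cases w) (simp add: inN_def zA_def projE_def)

lemma addE_eq_plus: "addE u v = u + v"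
  by (cases u; cases v) (simp add: addE_def)

lemma step_res_eq: "step_res H as h z \<mu> = psi H as h (embed z + DT \<mu>) + DT \<mu>"
  by (simp add: step_res_def addE_eq_plus)

definition stage :: "(real^('d::finite+'d) \<Rightarrow> real) \<Rightarrow> real \<Rightarrow> nat \<times> real \<Rightarrow> 'd ext \<Rightarrow> 'd ext" where
  "stage H h = (\<lambda>(i, a). if even i then flowA H (a * h) else flowB H (a * h))"

lemma psi_eq_fold: "psi H as h = fold (stage H h) (zip [0..<length as] as)"
proof -
  have "(\<lambda>(i, a) u. if even i then flowA H (a * h) u else flowB H (a * h) u) = stage H h"
    by (auto simp: stage_def fun_eq_iff)
  then show ?thesis
    by (intro ext) (simp only: psi_def)
qed

section \<open>Quadratic first integrals\<close>

definition polar :: "real^'n^'n \<Rightarrow> real^'n \<Rightarrow> real^'n \<Rightarrow> real" where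
  "polar C u v = u \<bullet> (C *v v) + v \<bullet> (C *v u)"

lemma polar_commute: "polar C u v = polar C v u"
  by (simp add: polar_def)

lemma polar_add_scaleR_right: "polar C u (v + t *\<^sub>R w) = polar C u v + t * polar C u w"
  by (simp add: polar_def algebra_simps)

lemma polar_plus_minus: "polar C (z + s) (z - s) = 2 * (z \<bullet> (C *v z)) - 2 * (s \<bullet> (C *v s))"
  unfolding polar_def matrix_vector_mult_diff_distrib matrix_vector_right_distrib
  by (simp add: inner_add_left inner_add_right inner_diff_left inner_diff_right)

lemma has_derivative_quadratic_form: "((\<lambda>z. z \<bullet> (C *v z)) has_derivative polar C z) (at z)"
  unfolding polar_def
  by (intro has_derivative_inner has_derivative_ident
      bounded_linear.has_derivative[OF matrix_vector_mul_bounded_linear])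

lemma first_integral_quadratic:
  assumes "first_integral H (\<lambda>z. z \<bullet> (C *v z))"
  shows "polar C z (XH H z) = 0"
  using assms has_derivative_unique[OF _ has_derivative_quadratic_form]
  unfolding first_integral_def by metis

lemma polar_stage_invariant:
  assumes "first_integral H (\<lambda>z. z \<bullet> (C *v z))"
  shows "polar C (zA (stage H h x w)) (zB (stage H h x w)) = polar C (zA w) (zB w)"
  using first_integral_quadratic[OF assms, of "zA w"] first_integral_quadratic[OF assms, of "zB w"]
  by (cases x) (auto simp: stage_def polar_add_scaleR_right polar_commute[of C _ "zB w"])

theorem is_step_quadratic_first_integral:
  assumes "first_integral H (\<lambda>z. z \<bullet> (C *v z))" "is_step H as h z0 z1"
  shows "z1 \<bullet> (C *v z1) = z0 \<bullet> (C *v z0)"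
proof -
  obtain \<mu> where \<mu>: "step_res H as h z0 \<mu> = embed z1"
    using assms(2) by (auto simp: is_step_def)
  define w where "w = embed z0 + DT \<mu>"
  define \<sigma> where "\<sigma> = zA (DT \<mu>)"
  have "zA (psi H as h w) = z1 - \<sigma>" "zB (psi H as h w) = z1 + \<sigma>"
    using \<mu> by (auto simp: step_res_eq ext_eq_iff w_def \<sigma>_def algebra_simps)
  moreover have "polar C (zA (psi H as h w)) (zB (psi H as h w)) = polar C (zA w) (zB w)"
    unfolding psi_eq_fold
    by (rule fold_invariant[where P = "\<lambda>u. polar C (zA u) (zB u) = polar C (zA w) (zB w)"])
      (simp_all add: polar_stage_invariant[OF assms(1)])
  ultimately have "polar C (z1 + \<sigma>) (z1 - \<sigma>) = polar C (z0 + \<sigma>) (z0 - \<sigma>)"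
    by (simp add: w_def \<sigma>_def polar_commute)
  then show ?thesis
    by (simp add: polar_plus_minus)
qed

section \<open>Affine symmetries\<close>

definition ext_map :: "(real^('d::finite+'d) \<Rightarrow> real^('d+'d)) \<Rightarrow> 'd ext \<Rightarrow> 'd ext" where
  "ext_map f w = ext_of (f (zA w)) (f (zB w))"

lemma stage_ext_map_affine:
  assumes "\<And>z. XH H (A *v z + b) = A *v XH H z"
  shows "stage H h x (ext_map (\<lambda>z. A *v z + b) w) = ext_map (\<lambda>z. A *v z + b) (stage H h x w)"
  using assms
  by (cases x) (simp add: stage_def ext_map_def ext_eq_iff algebra_simps)

lemma ext_map_affine_add_DT:
  assumes "zA (DT \<mu>') = A *v zA (DT \<mu>)"
  shows "ext_map (\<lambda>z. A *v z + b) u + DT \<mu>' = ext_map (\<lambda>z. A *v z + b) (u + DT \<mu>)"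
  using assms by (simp add: ext_map_def ext_eq_iff algebra_simps)

theorem is_step_affine_equivariant:
  assumes "\<And>z. XH H (A *v z + b) = A *v XH H z" "is_step H as h z0 z1"
  shows "is_step H as h (A *v z0 + b) (A *v z1 + b)"
proof -
  let ?aff = "\<lambda>z. A *v z + b"
  obtain \<mu> where \<mu>: "step_res H as h z0 \<mu> = embed z1"
    using assms(2) by (auto simp: is_step_def)
  define \<mu>' where "\<mu>' = mkz (- qpart (A *v zA (DT \<mu>))) (ppart (A *v zA (DT \<mu>)))"
  have DT': "zA (DT \<mu>') = A *v zA (DT \<mu>)"
    by (simp add: \<mu>'_def zA_DT phase_eq_iff)
  have "psi H as h (ext_map ?aff w) = ext_map ?aff (psi H as h w)" for w
    unfolding psi_eq_fold
    by (rule fold_commute_apply[symmetric]) (simp add: fun_eq_iff stage_ext_map_affine[OF assms(1)])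
  moreover have "embed (?aff z0) + DT \<mu>' = ext_map ?aff (embed z0 + DT \<mu>)"
    using ext_map_affine_add_DT[OF DT', of b "embed z0"] by (simp add: ext_map_def ext_eq_iff)
  ultimately have "step_res H as h (?aff z0) \<mu>' = ext_map ?aff (step_res H as h z0 \<mu>)"
    by (simp add: step_res_eq ext_map_affine_add_DT[OF DT'])
  also have "\<dots> = embed (?aff z1)"
    by (simp add: \<mu> ext_map_def ext_eq_iff)
  finally show ?thesis
    unfolding is_step_def by blast
qed

section \<open>Symplecticity\<close>

definition preserves_form :: "('a \<Rightarrow> 'a \<Rightarrow> real) \<Rightarrow> ('a \<Rightarrow> 'a) \<Rightarrow> bool" where
  "preserves_form B L \<longleftrightarrow> (\<forall>u v. B (L u) (L v) = B u v)"

lemma fold_has_derivative_preserves_form: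
  assumes "\<And>x w. \<exists>L. (f x has_derivative L) (at w) \<and> preserves_form B L"
  shows "\<exists>L. (fold f xs has_derivative L) (at w) \<and> preserves_form B L"
proof (induction xs arbitrary: w)
  case Nil
  show ?case
    by (auto simp: preserves_form_def intro: exI[of _ id] has_derivative_ident[unfolded id_def[symmetric]])
next
  case (Cons x xs)
  obtain L1 where L1: "(f x has_derivative L1) (at w)" "preserves_form B L1"
    using assms by blast
  obtain L2 where L2: "(fold f xs has_derivative L2) (at (f x w))" "preserves_form B L2"
    using Cons by blast
  have "(fold f (x # xs) has_derivative L2 \<circ> L1) (at w)"
    using has_derivative_compose[OF L1(1) L2(1)] by (simp add: comp_def)
  moreover have "preserves_form B (L2 \<circ> L1)"
    using L1(2) L2(2) by (simp add: preserves_form_def)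
  ultimately show ?case
    by blast
qed

text \<open>On \<open>(q, x, p, y)\<close>, \<open>ext_omega\<close> is the symplectic form \<open>dq \<and> dp + dx \<and> dy\<close>.\<close>

definition ext_omega :: "'d::finite ext \<Rightarrow> 'd ext \<Rightarrow> real" where
  "ext_omega d d' = omega (zA d) (zB d') + omega (zB d) (zA d')"

lemma ext_omega_plus_minus:
  "ext_omega (ext_of (a + s) (a - s)) (ext_of (b + t) (b - t)) = 2 * omega a b - 2 * omega s t"
  "ext_omega (ext_of (a - s) (a + s)) (ext_of (b - t) (b + t)) = 2 * omega a b - 2 * omega s t"
  by (simp_all add: ext_omega_def omega_bilinear)

lemma preserves_ext_omega_kickA:
  assumes "\<And>a b. omega (D a) b + omega a (D b) = 0"
  shows "preserves_form ext_omega (\<lambda>d. ext_of (zA d) (zB d + t *\<^sub>R D (zA d)))"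
  unfolding preserves_form_def
proof (intro allI)
  fix d d'
  have "t * omega (zA d) (D (zA d')) + t * omega (D (zA d)) (zA d') = 0"
    using assms[of "zA d" "zA d'"] by (simp add: add.commute flip: distrib_left)
  then show "ext_omega (ext_of (zA d) (zB d + t *\<^sub>R D (zA d)))
      (ext_of (zA d') (zB d' + t *\<^sub>R D (zA d'))) = ext_omega d d'"
    by (simp add: ext_omega_def omega_bilinear)
qed

lemma preserves_ext_omega_kickB:
  assumes "\<And>a b. omega (D a) b + omega a (D b) = 0"
  shows "preserves_form ext_omega (\<lambda>d. ext_of (zA d + t *\<^sub>R D (zB d)) (zB d))"
  unfolding preserves_form_def
proof (intro allI)
  fix d d'
  have "t * omega (zB d) (D (zB d')) + t * omega (D (zB d)) (zB d') = 0"
    using assms[of "zB d" "zB d'"] by (simp add: add.commute flip: distrib_left)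
  then show "ext_omega (ext_of (zA d + t *\<^sub>R D (zB d)) (zB d))
      (ext_of (zA d' + t *\<^sub>R D (zB d')) (zB d')) = ext_omega d d'"
    by (simp add: ext_omega_def omega_bilinear)
qed

lemma stage_symplectic:
  assumes "smooth_fun H"
  shows "\<exists>L. (stage H h x has_derivative L) (at w) \<and> preserves_form ext_omega L"
proof -
  obtain DX where DX: "\<And>z. (XH H has_derivative DX z) (at z)"
    and skew: "\<And>z a b. omega (DX z a) b + omega a (DX z b) = 0"
    using XH_derivative_skew[OF assms] by blast
  have dA: "(zA has_derivative zA) (at w)" and dB: "(zB has_derivative zB) (at w)"
    by (simp_all add: bounded_linear_zA bounded_linear_zB bounded_linear_imp_has_derivative)
  obtain i a where x: "x = (i, a)"
    by (cases x)
  show ?thesis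
  proof (cases "even i")
    case True
    have "stage H h x = (\<lambda>w. ext_of (zA w) (zB w + (a * h) *\<^sub>R XH H (zA w)))"
      by (simp add: fun_eq_iff stage_def x True ext_eq_iff)
    moreover have "((\<lambda>w. ext_of (zA w) (zB w + (a * h) *\<^sub>R XH H (zA w))) has_derivative
        (\<lambda>d. ext_of (zA d) (zB d + (a * h) *\<^sub>R DX (zA w) (zA d)))) (at w)"
      by (intro has_derivative_ext_of dA has_derivative_add dB has_derivative_scaleR_right
          has_derivative_compose[OF dA DX])
    ultimately show ?thesis
      using preserves_ext_omega_kickA[OF skew] by auto
  next
    case False
    have "stage H h x = (\<lambda>w. ext_of (zA w + (a * h) *\<^sub>R XH H (zB w)) (zB w))"
      by (simp add: fun_eq_iff stage_def x False ext_eq_iff)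
    moreover have "((\<lambda>w. ext_of (zA w + (a * h) *\<^sub>R XH H (zB w)) (zB w)) has_derivative
        (\<lambda>d. ext_of (zA d + (a * h) *\<^sub>R DX (zB w) (zB d)) (zB d))) (at w)"
      by (intro has_derivative_ext_of dB has_derivative_add dA has_derivative_scaleR_right
          has_derivative_compose[OF dB DX])
    ultimately show ?thesis
      using preserves_ext_omega_kickB[OF skew] by auto
  qed
qed

text \<open>The shift \<open>\<sigma>\<close> enters \<open>ext_omega\<close> as \<open>-2 \<omega>(\<sigma>, \<sigma>')\<close> on both sides and cancels.\<close>

lemma preserves_omega_of_symmetric_shift:
  assumes "preserves_form ext_omega L"
    and "\<And>d. L (ext_of (d + \<sigma> d) (d - \<sigma> d)) = ext_of (\<Phi>' d - \<sigma> d) (\<Phi>' d + \<sigma> d)"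
  shows "preserves_form omega \<Phi>'"
  unfolding preserves_form_def
proof (intro allI)
  fix u v
  have "2 * omega (\<Phi>' u) (\<Phi>' v) - 2 * omega (\<sigma> u) (\<sigma> v)
      = ext_omega (L (ext_of (u + \<sigma> u) (u - \<sigma> u))) (L (ext_of (v + \<sigma> v) (v - \<sigma> v)))"
    by (simp add: assms(2) ext_omega_plus_minus)
  also have "\<dots> = 2 * omega u v - 2 * omega (\<sigma> u) (\<sigma> v)"
    using assms(1) ext_omega_plus_minus(1) unfolding preserves_form_def by metis
  finally show "omega (\<Phi>' u) (\<Phi>' v) = omega u v"
    by simp
qed

lemma step_res_has_derivative:
  assumes "smooth_fun H" "(\<mu> has_derivative m) (at z)"
  obtains L where "preserves_form ext_omega L"
    and "((\<lambda>x. step_res H as h x (\<mu> x)) has_derivative (\<lambda>d. L (embed d + DT (m d)) + DT (m d))) (at z)"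
proof -
  define W where "W x = embed x + DT (\<mu> x)" for x
  have dW: "(W has_derivative (\<lambda>d. embed d + DT (m d))) (at z)"
    unfolding W_def
    by (intro has_derivative_add bounded_linear.has_derivative[OF bounded_linear_embed has_derivative_ident]
        bounded_linear.has_derivative[OF bounded_linear_DT assms(2)])
  obtain L where L: "(psi H as h has_derivative L) (at (W z))" "preserves_form ext_omega L"
    unfolding psi_eq_fold
    using fold_has_derivative_preserves_form[where f = "stage H h", OF stage_symplectic[OF assms(1)]]
    by blast
  have "((\<lambda>x. step_res H as h x (\<mu> x)) has_derivative (\<lambda>d. L (embed d + DT (m d)) + DT (m d))) (at z)"
    unfolding step_res_eq W_def[symmetric]
    by (rule has_derivative_add[OF has_derivative_compose[OF dW L(1)]
          bounded_linear.has_derivative[OF bounded_linear_DT assms(2)]])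
  with L(2) show ?thesis
    by (rule that)
qed

text \<open>On \<open>U\<close> the result lies in \<open>\<N>\<close>, so the derivatives of its two copies \<open>zA\<close> and \<open>zB\<close>
  agree.\<close>

theorem step_map_symplectic:
  assumes "smooth_fun H" "open U" "z \<in> U"
    and "\<And>z. z \<in> U \<Longrightarrow> \<mu> differentiable (at z) \<and> inN (step_res H as h z (\<mu> z))"
  shows "\<exists>\<Phi>'. ((\<lambda>w. projE (step_res H as h w (\<mu> w))) has_derivative \<Phi>') (at z)
           \<and> preserves_form omega \<Phi>'"
proof -
  obtain m where m: "(\<mu> has_derivative m) (at z)"
    using assms(3,4) unfolding differentiable_def by blast
  define W' where "W' d = embed d + DT (m d)" for d
  obtain L where L: "preserves_form ext_omega L"
    and dR: "((\<lambda>x. step_res H as h x (\<mu> x)) has_derivative (\<lambda>d. L (W' d) + DT (m d))) (at z)"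
    using step_res_has_derivative[OF assms(1) m] unfolding W'_def by blast
  have dA: "((\<lambda>x. zA (step_res H as h x (\<mu> x))) has_derivative (\<lambda>d. zA (L (W' d) + DT (m d)))) (at z)"
    by (rule bounded_linear.has_derivative[OF bounded_linear_zA dR])
  have dB: "((\<lambda>x. zB (step_res H as h x (\<mu> x))) has_derivative (\<lambda>d. zB (L (W' d) + DT (m d)))) (at z)"
    by (rule bounded_linear.has_derivative[OF bounded_linear_zB dR])
  define \<Phi>' where "\<Phi>' d = zA (L (W' d) + DT (m d))" for d
  have \<Phi>': "((\<lambda>w. projE (step_res H as h w (\<mu> w))) has_derivative \<Phi>') (at z)"
    unfolding \<Phi>'_def
    by (rule has_derivative_transform_within_open[OF dA assms(2,3)]) (simp add: assms(4) projE_inN)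
  have "((\<lambda>x. zB (step_res H as h x (\<mu> x))) has_derivative \<Phi>') (at z)"
    unfolding \<Phi>'_def
    by (rule has_derivative_transform_within_open[OF dA assms(2,3)]) (simp add: assms(4) inN_iff[symmetric])
  then have AB: "(\<lambda>d. zB (L (W' d) + DT (m d))) = \<Phi>'"
    by (rule has_derivative_unique[OF dB])
  define \<sigma> where "\<sigma> d = zA (DT (m d))" for d
  have W': "W' d = ext_of (d + \<sigma> d) (d - \<sigma> d)" for d
    by (simp add: ext_eq_iff W'_def \<sigma>_def)
  have "L (W' d) = ext_of (\<Phi>' d - \<sigma> d) (\<Phi>' d + \<sigma> d)" for d
    using fun_cong[OF AB, of d] by (auto simp: ext_eq_iff \<Phi>'_def \<sigma>_def)
  then have "L (ext_of (d + \<sigma> d) (d - \<sigma> d)) = ext_of (\<Phi>' d - \<sigma> d) (\<Phi>' d + \<sigma> d)" for d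
    by (simp only: W'[symmetric])
  then have "preserves_form omega \<Phi>'"
    by (rule preserves_omega_of_symmetric_shift[OF L])
  with \<Phi>' show ?thesis
    by blast
qed

definition antideriv :: "'a::field_char_0 poly \<Rightarrow> 'a poly" where
  "antideriv p = (\<Sum>k\<le>degree p. monom (coeff p k / of_nat (Suc k)) (Suc k))"

lemma coeff_antideriv: "coeff (antideriv p) n = (if n = 0 then 0 else coeff p (n - 1) / of_nat n)"
proof -
  have "coeff (antideriv p) n = (\<Sum>k\<le>degree p. if Suc k = n then coeff p k / of_nat (Suc k) else 0)"
    unfolding antideriv_def coeff_sum coeff_monom by (intro sum.cong) auto
  also have "\<dots> = (if n = 0 then 0 else coeff p (n - 1) / of_nat n)"
    by (cases n) (auto simp: coeff_eq_0 not_le)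
  finally show ?thesis .
qed

lemma antideriv_0 [simp]: "antideriv 0 = 0"
  by (simp add: poly_eq_iff coeff_antideriv)

lemma antideriv_add: "antideriv (p + q) = antideriv p + antideriv q"
  by (simp add: poly_eq_iff coeff_antideriv add_divide_distrib)

lemma antideriv_smult: "antideriv (smult a p) = smult a (antideriv p)"
  by (simp add: poly_eq_iff coeff_antideriv)

lemma antideriv_sum: "antideriv (\<Sum>j\<in>S. f j) = (\<Sum>j\<in>S. antideriv (f j))"
  by (induction S rule: infinite_finite_induct) (auto simp: antideriv_add)

lemma antideriv_monom: "antideriv (monom a m) = monom (a / of_nat (Suc m)) (Suc m)"
  by (auto simp: poly_eq_iff coeff_antideriv)

lemma poly_antideriv_0 [simp]: "poly (antideriv p) 0 = 0"
  by (simp add: poly_0_coeff_0 coeff_antideriv)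

lemma pderiv_antideriv [simp]: "pderiv (antideriv p) = p"
  by (simp add: poly_eq_iff coeff_pderiv coeff_antideriv del: of_nat_Suc)

lemma antideriv_pderiv: "antideriv (pderiv p) = p - [:poly p 0:]"
  by (auto simp: poly_eq_iff coeff_antideriv coeff_pderiv poly_0_coeff_0 coeff_pCons
      simp del: of_nat_Suc split: nat.split)

lemma degree_antideriv_le: "degree (antideriv p) \<le> Suc (degree p)"
  by (rule degree_le) (auto simp: coeff_antideriv coeff_eq_0)

definition integral01 :: "'a::field_char_0 poly \<Rightarrow> 'a" where
  "integral01 p = poly (antideriv p) 1"

lemma integral01_add: "integral01 (p + q) = integral01 p + integral01 q"
  by (simp add: integral01_def antideriv_add)

lemma integral01_smult: "integral01 (smult a p) = a * integral01 p"
  by (simp add: integral01_def antideriv_smult)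

lemma integral01_sum: "integral01 (\<Sum>j\<in>S. f j) = (\<Sum>j\<in>S. integral01 (f j))"
  by (simp add: integral01_def antideriv_sum poly_sum)

lemma integral01_monom: "integral01 (monom 1 m) = 1 / of_nat (Suc m)"
  by (simp add: integral01_def antideriv_monom poly_monom)

lemma integral01_pderiv: "integral01 (pderiv p) = poly p 1 - poly p 0"
  by (simp add: integral01_def antideriv_pderiv)

lemma integral01_by_parts:
  "integral01 (pderiv p * q) = poly p 1 * poly q 1 - poly p 0 * poly q 0 - integral01 (p * pderiv q)"
proof -
  have "integral01 (pderiv (p * q)) = integral01 (pderiv p * q) + integral01 (p * pderiv q)"
    by (metis pderiv_mult integral01_add add.commute mult.commute)
  moreover have "integral01 (pderiv (p * q)) = poly p 1 * poly q 1 - poly p 0 * poly q 0"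
    by (simp add: integral01_pderiv)
  ultimately show ?thesis
    by (metis eq_diff_eq)
qed

section \<open>Gauss nodes\<close>

text \<open>\<open>rodrigues s s\<close> is \<open>s!\<close> times the shifted Legendre polynomial of degree \<open>s\<close> on \<open>[0, 1]\<close>.\<close>

definition rodrigues :: "nat \<Rightarrow> nat \<Rightarrow> real poly" where
  "rodrigues s k = (pderiv ^^ k) (([:0, 1:] * [:-1, 1:]) ^ s)"

lemma rodrigues_Suc: "rodrigues s (Suc k) = pderiv (rodrigues s k)"
  by (simp add: rodrigues_def)

lemma degree_rodrigues: "degree (rodrigues s k) = 2 * s - k"
  by (simp add: rodrigues_def degree_higher_pderiv degree_power_eq degree_mult_eq)

lemma power_dvd_pderiv:
  fixes p :: "'a::{idom,semiring_char_0} poly"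
  assumes "[:-a, 1:] ^ Suc m dvd p"
  shows "[:-a, 1:] ^ m dvd pderiv p"
proof -
  obtain r where r: "p = [:-a, 1:] ^ Suc m * r"
    using assms by (auto simp: dvd_def)
  have "pderiv p = [:-a, 1:] ^ m * ([:-a, 1:] * pderiv r + smult (of_nat (Suc m)) r)"
    unfolding r pderiv_mult pderiv_power_Suc by (simp add: pderiv_pCons algebra_simps)
  then show ?thesis by simp
qed

lemma rodrigues_root_power_dvd:
  assumes "k \<le> s" "a \<in> {0, 1}"
  shows "[:-a, 1:] ^ (s - k) dvd rodrigues s k"
  using assms(1)
proof (induction k)
  case 0
  have "rodrigues s 0 = [:0, 1:] ^ s * [:-1, 1:] ^ s"
    by (simp only: rodrigues_def funpow_0 power_mult_distrib)
  then show ?case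
    using assms(2) by auto
next
  case (Suc k)
  then have "[:-a, 1:] ^ Suc (s - Suc k) dvd rodrigues s k"
    by (simp add: Suc_diff_Suc)
  then show ?case
    unfolding rodrigues_Suc by (rule power_dvd_pderiv)
qed

lemma poly_rodrigues_0_1:
  assumes "k < s" "a \<in> {0, 1}"
  shows "poly (rodrigues s k) a = 0"
proof -
  have "[:-a, 1:] dvd [:-a, 1:] ^ (s - k)"
    using assms(1) by simp
  then have "[:-a, 1:] dvd rodrigues s k"
    using rodrigues_root_power_dvd[of k s a] assms by (meson dvd_trans less_imp_le)
  then show ?thesis by (simp add: poly_eq_0_iff_dvd)
qed

text \<open>Orthogonality of the Legendre polynomial to lower degrees: integrate by parts \<open>m\<close> times,
  the boundary terms vanishing because \<open>rodrigues s k\<close> has roots \<open>0\<close> and \<open>1\<close> for \<open>k < s\<close>.\<close>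

lemma integral01_rodrigues_by_parts:
  assumes "m \<le> s"
  shows "integral01 (rodrigues s s * q) = (-1) ^ m * integral01 (rodrigues s (s - m) * (pderiv ^^ m) q)"
  using assms
proof (induction m)
  case (Suc m)
  have s: "s - m = Suc (s - Suc m)"
    using Suc.prems by simp
  have "integral01 (rodrigues s (s - m) * (pderiv ^^ m) q)
      = - integral01 (rodrigues s (s - Suc m) * (pderiv ^^ Suc m) q)"
    using Suc.prems by (simp add: s rodrigues_Suc integral01_by_parts poly_rodrigues_0_1)
  then show ?case
    using Suc by simp
qed simp

lemma integral01_rodrigues_orthogonal:
  assumes "degree q < s"
  shows "integral01 (rodrigues s s * q) = 0"
proof -
  have "(pderiv ^^ s) q = 0"
    using assms by (simp add: poly_eq_iff coeff_higher_pderiv coeff_eq_0)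
  then show ?thesis
    using integral01_rodrigues_by_parts[of s s q] by (simp add: integral01_def)
qed

lemma pderiv_root_between:
  fixes p :: "real poly"
  assumes "a < b" "poly p a = 0" "poly p b = 0"
  obtains z where "a < z" "z < b" "poly (pderiv p) z = 0"
proof -
  have "continuous_on {a..b} (poly p)"
    by (intro continuous_intros)
  then obtain z where "a < z" "z < b" "DERIV (poly p) z :> 0"
    using Rolle[of a b "poly p"] assms by auto
  then show ?thesis
    using that poly_DERIV DERIV_unique by blast
qed

lemma increasing_chain_less:
  fixes r :: "nat \<Rightarrow> 'a::order"
  assumes "\<And>j. j < n \<Longrightarrow> r j < r (Suc j)" "i < j" "j \<le> n"
  shows "r i < r j"
  using assms(2,3) by (induction i j rule: less_Suc_induct) (auto intro: assms(1) order.strict_trans)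

lemma pderiv_roots_interlace:
  fixes p :: "real poly"
  assumes "\<And>j. j < n \<Longrightarrow> r j < r (Suc j)" "\<And>j. j \<le> n \<Longrightarrow> poly p (r j) = 0"
  obtains \<xi> where "\<And>j. j < n \<Longrightarrow> r j < \<xi> j \<and> \<xi> j < r (Suc j) \<and> poly (pderiv p) (\<xi> j) = 0"
proof -
  have "\<forall>j. \<exists>z. j < n \<longrightarrow> r j < z \<and> z < r (Suc j) \<and> poly (pderiv p) z = 0"
    by (metis assms pderiv_root_between less_imp_le Suc_leI)
  then show ?thesis
    using that by metis
qed

text \<open>Rolle's theorem, applied \<open>k\<close> times to \<open>x\<^sup>s (x - 1)\<^sup>s\<close> (the endpoints remaining roots while \<open>k < s\<close>).\<close>

lemma rodrigues_root_chain:
  assumes "k < s"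
  shows "\<exists>r. r 0 = 0 \<and> r (Suc k) = 1 \<and> (\<forall>j\<le>Suc k. poly (rodrigues s k) (r j) = 0)
           \<and> (\<forall>j\<le>k. r j < r (Suc j))"
  using assms
proof (induction k)
  case 0
  show ?case
    by (rule exI[of _ real]) (use 0 poly_rodrigues_0_1 in \<open>auto simp: le_Suc_eq\<close>)
next
  case (Suc k)
  then obtain r where r: "r 0 = 0" "r (Suc k) = 1"
    "\<And>j. j \<le> Suc k \<Longrightarrow> poly (rodrigues s k) (r j) = 0" "\<And>j. j \<le> k \<Longrightarrow> r j < r (Suc j)"
    by auto
  obtain \<xi> where \<xi>: "\<And>j. j \<le> k \<Longrightarrow> r j < \<xi> j \<and> \<xi> j < r (Suc j) \<and> poly (rodrigues s (Suc k)) (\<xi> j) = 0"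
    using pderiv_roots_interlace[of "Suc k" r "rodrigues s k"] r(3,4) unfolding rodrigues_Suc
    by (metis less_Suc_eq_le)
  define r' where "r' j = (if j = 0 then 0 else if j = Suc (Suc k) then 1 else \<xi> (j - 1))" for j
  have "poly (rodrigues s (Suc k)) (r' j) = 0" if "j \<le> Suc (Suc k)" for j
    using \<xi>[of "j - 1"] poly_rodrigues_0_1[OF Suc.prems] that by (auto simp: r'_def)
  moreover have "r' j < r' (Suc j)" if "j \<le> Suc k" for j
  proof -
    have "\<xi> (j - 1) < r j" if "0 < j"
      using \<xi>[of "j - 1"] that \<open>j \<le> Suc k\<close> by simp
    then show ?thesis
      using \<xi>[of 0] \<xi>[of k] \<xi>[of j] r(1,2) that by (auto simp: r'_def)
  qed
  ultimately show ?case
    by (intro exI[of _ r']) (simp add: r'_def)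
qed

lemma gauss_nodes:
  assumes "0 < s"
  obtains c where "inj_on c {..<s}" "\<And>j. j < s \<Longrightarrow> 0 < c j \<and> c j < 1 \<and> poly (rodrigues s s) (c j) = 0"
proof -
  obtain r where r: "r 0 = 0" "r s = 1" "\<And>j. j \<le> s \<Longrightarrow> poly (rodrigues s (s - 1)) (r j) = 0"
    "\<And>j. j < s \<Longrightarrow> r j < r (Suc j)"
    using rodrigues_root_chain[of "s - 1" s] assms by (auto simp: less_Suc_eq_le)
  obtain c where c: "\<And>j. j < s \<Longrightarrow> r j < c j \<and> c j < r (Suc j) \<and> poly (rodrigues s s) (c j) = 0"
    using pderiv_roots_interlace[of s r "rodrigues s (s - 1)"] r(3,4) assms
    by (metis Suc_diff_1 rodrigues_Suc)
  have r_bounds: "0 \<le> r j \<and> r j \<le> 1" if "j \<le> s" for j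
    using increasing_chain_less[of s r 0 j] increasing_chain_less[of s r j s] r that by (cases "j = 0"; cases "j = s") auto
  have "c i < c j" if "i < j" "j < s" for i j
    using increasing_chain_less[of s r "Suc i" j] c[of i] c[of j] r(4) that
    by (cases "Suc i = j") (auto intro: order.strict_trans)
  then have "inj_on c {..<s}"
    by (metis inj_onI lessThan_iff linorder_neqE_nat order_less_irrefl)
  moreover have "0 < c j \<and> c j < 1 \<and> poly (rodrigues s s) (c j) = 0" if "j < s" for j
    using c[OF that] r_bounds[of j] r_bounds[of "Suc j"] that by auto
  ultimately show ?thesis
    using that by blast
qed

section \<open>Gauss collocation methods\<close>

definition lagrange_basis :: "(nat \<Rightarrow> 'a::field) \<Rightarrow> nat \<Rightarrow> nat \<Rightarrow> 'a poly" where
  "lagrange_basis c s j = (\<Prod>k\<in>{..<s} - {j}. smult (1 / (c j - c k)) [:- c k, 1:])"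

lemma poly_lagrange_basis:
  assumes "inj_on c {..<s}" "i < s" "j < s"
  shows "poly (lagrange_basis c s j) (c i) = (if i = j then 1 else 0)"
proof -
  have "poly (lagrange_basis c s j) (c i) = (\<Prod>k\<in>{..<s} - {j}. (c i - c k) / (c j - c k))"
    unfolding lagrange_basis_def poly_prod by (intro prod.cong) (auto simp: diff_divide_distrib)
  also have "\<dots> = (if i = j then 1 else 0)"
  proof (cases "i = j")
    case True
    have "c j \<noteq> c k" if "k \<in> {..<s} - {j}" for k
      using assms(1,3) that by (auto dest: inj_onD)
    then show ?thesis
      using True by (simp add: prod.neutral)
  next
    case False
    have "(\<Prod>k\<in>{..<s} - {j}. (c i - c k) / (c j - c k)) = 0"
      using False assms(2) by (intro prod_zero) auto
    then show ?thesis
      using False by simp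
  qed
  finally show ?thesis .
qed

lemma degree_lagrange_basis:
  assumes "j < s"
  shows "degree (lagrange_basis c s j) \<le> s - 1"
proof -
  have "degree (lagrange_basis c s j) \<le> (\<Sum>k\<in>{..<s} - {j}. degree (smult (1 / (c j - c k)) [:- c k, 1:]))"
    unfolding lagrange_basis_def by (rule degree_prod_sum_le[unfolded comp_def]) simp
  also have "\<dots> \<le> (\<Sum>k\<in>{..<s} - {j}. 1)"
    by (intro sum_mono) (simp add: degree_smult_le)
  finally show ?thesis
    using assms by simp
qed

lemma lagrange_interpolation:
  assumes "inj_on c {..<s}" "degree q < s"
  shows "q = (\<Sum>j<s. smult (poly q (c j)) (lagrange_basis c s j))"
proof (rule poly_eqI_degree[where A = "c ` {..<s}"])
  fix x
  assume "x \<in> c ` {..<s}"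
  then obtain i where i: "i < s" "x = c i"
    by auto
  have "poly (\<Sum>j<s. smult (poly q (c j)) (lagrange_basis c s j)) x = (\<Sum>j<s. if i = j then poly q (c j) else 0)"
    unfolding poly_sum poly_smult i(2) by (intro sum.cong) (auto simp: poly_lagrange_basis assms i)
  then show "poly q x = poly (\<Sum>j<s. smult (poly q (c j)) (lagrange_basis c s j)) x"
    using i by simp
next
  have "degree (\<Sum>j<s. smult (poly q (c j)) (lagrange_basis c s j)) \<le> s - 1"
    by (intro degree_sum_le) (use degree_lagrange_basis in \<open>auto intro: order.trans[OF degree_smult_le]\<close>)
  then show "degree (\<Sum>j<s. smult (poly q (c j)) (lagrange_basis c s j)) < card (c ` {..<s})"
    using assms by (simp add: card_image)
qed (use assms in \<open>simp add: card_image\<close>)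

text \<open>Dividing by the Legendre polynomial, the quotient integrates to zero by orthogonality
  and the remainder is integrated exactly by interpolation.\<close>

lemma gauss_quadrature:
  fixes c :: "nat \<Rightarrow> real"
  assumes "inj_on c {..<s}" "\<And>j. j < s \<Longrightarrow> poly (rodrigues s s) (c j) = 0"
    and "degree f < 2 * s"
  shows "(\<Sum>j<s. integral01 (lagrange_basis c s j) * poly f (c j)) = integral01 f"
proof -
  define P where "P = rodrigues s s"
  define q where "q = f div P"
  define r where "r = f mod P"
  have s: "0 < s"
    using assms(3) by simp
  have P: "degree P = s" "P \<noteq> 0"
    using s by (auto simp: P_def degree_rodrigues dest: arg_cong[of _ _ degree])
  have f: "f = P * q + r"
    by (simp add: q_def r_def)
  have "degree r < s"
    using degree_mod_less[OF P(2), of f] P(1) s by (auto simp: r_def)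
  have "degree q < s"
  proof (cases "q = 0")
    case False
    have "degree (P * q) = s + degree q"
      using False P by (simp add: degree_mult_eq)
    moreover have "degree (P * q) \<le> max (degree f) (degree r)"
      using degree_diff_le_max[of f r] f by simp
    ultimately show ?thesis
      using assms(3) \<open>degree r < s\<close> by linarith
  qed (use s in simp)
  have "integral01 f = integral01 (P * q) + integral01 r"
    using f by (simp add: integral01_add)
  also have "integral01 (P * q) = 0"
    unfolding P_def by (rule integral01_rodrigues_orthogonal) fact
  also have "integral01 r = (\<Sum>j<s. poly r (c j) * integral01 (lagrange_basis c s j))"
    by (subst lagrange_interpolation[OF assms(1) \<open>degree r < s\<close>]) (simp add: integral01_sum integral01_smult)
  also have "\<dots> = (\<Sum>j<s. integral01 (lagrange_basis c s j) * poly f (c j))"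
    using assms(2) by (intro sum.cong) (auto simp: f P_def)
  finally show ?thesis by simp
qed

definition colloc_A :: "(nat \<Rightarrow> real) \<Rightarrow> nat \<Rightarrow> nat \<Rightarrow> nat \<Rightarrow> real" where
  "colloc_A c s i j = poly (antideriv (lagrange_basis c s j)) (c i)"

definition colloc_b :: "(nat \<Rightarrow> real) \<Rightarrow> nat \<Rightarrow> nat \<Rightarrow> real" where
  "colloc_b c s j = integral01 (lagrange_basis c s j)"

lemma colloc_A_powers:
  assumes "inj_on c {..<s}" "m < s"
  shows "(\<Sum>j<s. colloc_A c s i j * c j ^ m) = c i ^ Suc m / of_nat (Suc m)"
proof -
  have "monom 1 m = (\<Sum>j<s. smult (c j ^ m) (lagrange_basis c s j))"
    using lagrange_interpolation[OF assms(1), of "monom 1 m"] assms(2) by (simp add: degree_monom_eq poly_monom)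
  then have "poly (antideriv (monom 1 m)) (c i) = (\<Sum>j<s. colloc_A c s i j * c j ^ m)"
    by (simp add: antideriv_sum antideriv_smult poly_sum colloc_A_def mult.commute)
  then show ?thesis
    by (simp add: antideriv_monom poly_monom)
qed

lemma colloc_b_powers:
  assumes "inj_on c {..<s}" "\<And>j. j < s \<Longrightarrow> poly (rodrigues s s) (c j) = 0" "m < 2 * s"
  shows "(\<Sum>j<s. colloc_b c s j * c j ^ m) = 1 / of_nat (Suc m)"
  using gauss_quadrature[OF assms(1,2), of "monom 1 m"] assms(3)
  by (simp add: degree_monom_eq colloc_b_def poly_monom integral01_monom)

text \<open>Both \<open>b\<^sub>i a\<^sub>i\<^sub>j\<close> and \<open>b\<^sub>j a\<^sub>j\<^sub>i\<close> are Gauss quadratures of products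
  \<open>\<ell>\<^sub>i L\<^sub>j\<close>, \<open>\<ell>\<^sub>j L\<^sub>i\<close> (\<open>L\<close> the antiderivatives), exact by degree, and summing them
  integrates \<open>(L\<^sub>i L\<^sub>j)'\<close>.\<close>

lemma colloc_symplectic:
  assumes "inj_on c {..<s}" "\<And>j. j < s \<Longrightarrow> poly (rodrigues s s) (c j) = 0" "i < s" "j < s"
  shows "colloc_b c s i * colloc_b c s j - colloc_b c s i * colloc_A c s i j
           - colloc_b c s j * colloc_A c s j i = 0"
proof -
  let ?l = "lagrange_basis c s"
  have weighted: "integral01 (?l a * antideriv (?l b)) = colloc_b c s a * colloc_A c s a b"
    if "a < s" "b < s" for a b
  proof -
    have "degree (?l a * antideriv (?l b)) \<le> (s - 1) + Suc (s - 1)"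
      using degree_mult_le[of "?l a" "antideriv (?l b)"] degree_lagrange_basis[OF that(1), of c]
        degree_antideriv_le[of "?l b"] degree_lagrange_basis[OF that(2), of c] by linarith
    then have "degree (?l a * antideriv (?l b)) < 2 * s"
      using that by linarith
    then have "integral01 (?l a * antideriv (?l b))
        = (\<Sum>k<s. integral01 (?l k) * poly (?l a * antideriv (?l b)) (c k))"
      using gauss_quadrature[OF assms(1,2)] by presburger
    also have "\<dots> = (\<Sum>k<s. if k = a then integral01 (?l k) * poly (antideriv (?l b)) (c k) else 0)"
      by (intro sum.cong) (auto simp: poly_lagrange_basis[OF assms(1)] that)
    finally show ?thesis
      using that by (simp add: colloc_b_def colloc_A_def)
  qed
  have "integral01 (pderiv (antideriv (?l i) * antideriv (?l j)))
      = integral01 (?l j * antideriv (?l i)) + integral01 (?l i * antideriv (?l j))"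
    by (simp add: pderiv_mult integral01_add mult.commute)
  moreover have "integral01 (pderiv (antideriv (?l i) * antideriv (?l j))) = colloc_b c s i * colloc_b c s j"
    unfolding integral01_pderiv by (simp add: colloc_b_def integral01_def)
  ultimately show ?thesis
    using weighted[OF assms(3,4)] weighted[OF assms(4,3)] by simp
qed

section \<open>Order conditions from the simplifying assumptions\<close>

lemma tord_pos: "0 < tord t"
  by (cases t) simp

lemma ew_eq_of_C:
  fixes A :: "nat \<Rightarrow> nat \<Rightarrow> real"
  assumes C: "\<And>m i. m + 1 < p \<Longrightarrow> i < s \<Longrightarrow> (\<Sum>j<s. A i j * c j ^ m) = c i ^ Suc m / of_nat (Suc m)"
  shows "tord t \<le> p \<Longrightarrow> i < s \<Longrightarrow> ew s A t i = c i ^ (tord t - 1) * real (tord t) / real (tgamma t)"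
proof (induction t arbitrary: i)
  case (Node ts)
  have child: "(\<Sum>j<s. A i j * ew s A u j) = c i ^ tord u / real (tgamma u)" if "u \<in> set ts" for u
  proof -
    have "tord u \<le> sum_list (map tord ts)"
      using that by (simp add: member_le_sum_list)
    then have "tord u < p"
      using Node.prems by simp
    have "(\<Sum>j<s. A i j * ew s A u j) = (\<Sum>j<s. A i j * c j ^ (tord u - 1)) * (real (tord u) / real (tgamma u))"
      unfolding sum_distrib_right using Node.IH[OF that] \<open>tord u < p\<close> by (intro sum.cong) auto
    also have "\<dots> = c i ^ tord u / real (tgamma u)"
      using C[of "tord u - 1" i] \<open>tord u < p\<close> tord_pos[of u] Node.prems by simp
    finally show ?thesis .
  qed
  have prod_quot: "prod_list (map (\<lambda>u. x ^ f u / real (g u)) us) = x ^ sum_list (map f us) / real (prod_list (map g us))"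
    for x :: real and f g :: "rtree \<Rightarrow> nat" and us
    by (induction us) (auto simp: power_add)
  have "ew s A (Node ts) i = prod_list (map (\<lambda>u. c i ^ tord u / real (tgamma u)) ts)"
    using child by (simp cong: map_cong)
  also have "\<dots> = c i ^ sum_list (map tord ts) / real (prod_list (map tgamma ts))"
    by (rule prod_quot)
  also have "\<dots> = c i ^ (tord (Node ts) - 1) * real (tord (Node ts)) / real (tgamma (Node ts))"
    by (simp only: tgamma.simps of_nat_mult mult_divide_mult_cancel_left_if) simp
  finally show ?case .
qed

lemma rk_order_ge_of_B_C:
  fixes A :: "nat \<Rightarrow> nat \<Rightarrow> real"
  assumes C: "\<And>m i. m + 1 < p \<Longrightarrow> i < s \<Longrightarrow> (\<Sum>j<s. A i j * c j ^ m) = c i ^ Suc m / of_nat (Suc m)"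
    and B: "\<And>m. m < p \<Longrightarrow> (\<Sum>i<s. b i * c i ^ m) = 1 / of_nat (Suc m)"
  shows "rk_order_ge s A b p"
  unfolding rk_order_ge_def
proof (intro allI impI)
  fix t
  assume t: "tord t \<le> p"
  have "(\<Sum>i<s. b i * ew s A t i) = (\<Sum>i<s. b i * c i ^ (tord t - 1)) * (real (tord t) / real (tgamma t))"
    unfolding sum_distrib_right using ew_eq_of_C[OF C t] by (intro sum.cong) auto
  also have "\<dots> = 1 / real (tgamma t)"
    using B[of "tord t - 1"] t tord_pos[of t] by simp
  finally show "(\<Sum>i<s. b i * ew s A t i) = 1 / real (tgamma t)" .
qed

section \<open>Splitting the collocation matrix into rank one plus nilpotent\<close>

definition antideriv_trunc :: "nat \<Rightarrow> 'a::field_char_0 poly \<Rightarrow> 'a poly" where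
  "antideriv_trunc s q = antideriv q - monom (coeff (antideriv q) s) s"

lemma coeff_antideriv_trunc:
  "coeff (antideriv_trunc s q) n = (if n = s then 0 else coeff (antideriv q) n)"
  by (simp add: antideriv_trunc_def)

lemma antideriv_trunc_smult: "antideriv_trunc s (smult a q) = smult a (antideriv_trunc s q)"
  by (simp add: poly_eq_iff coeff_antideriv_trunc antideriv_smult)

lemma antideriv_trunc_sum: "antideriv_trunc s (\<Sum>j\<in>S. f j) = (\<Sum>j\<in>S. antideriv_trunc s (f j))"
  by (simp add: poly_eq_iff coeff_antideriv_trunc antideriv_sum coeff_sum)

lemma degree_antideriv_trunc:
  assumes "degree q < s"
  shows "degree (antideriv_trunc s q) < s"
proof -
  have "coeff (antideriv_trunc s q) n = 0" if "s - 1 < n" for n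
    using assms that by (auto simp: coeff_antideriv_trunc coeff_antideriv coeff_eq_0)
  then have "degree (antideriv_trunc s q) \<le> s - 1"
    by (intro degree_le) auto
  then show ?thesis
    using assms by linarith
qed

lemma antideriv_trunc_map_of_real:
  "antideriv_trunc s (map_poly complex_of_real p) = map_poly complex_of_real (antideriv_trunc s p)"
  by (simp add: poly_eq_iff coeff_antideriv_trunc coeff_antideriv coeff_map_poly)

lemma poly_map_poly_of_real: "poly (map_poly of_real p) (of_real x) = of_real (poly p x)"
  by (induction p) (auto simp: map_poly_pCons)

text \<open>\<open>antideriv_trunc s\<close> raises the lowest degree with a nonzero coefficient, so it has no
  eigenvector for a nonzero eigenvalue.\<close>

lemma antideriv_trunc_eigenvector:
  assumes "antideriv_trunc s Q = smult e Q" "e \<noteq> 0"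
  shows "Q = 0"
proof -
  have "coeff Q n = 0" for n
  proof (induction n rule: less_induct)
    case (less n)
    have "e * coeff Q n = coeff (antideriv_trunc s Q) n"
      using assms(1) by simp
    also have "\<dots> = 0"
      using less[of "n - 1"] by (auto simp: coeff_antideriv_trunc coeff_antideriv)
    finally show ?case
      using assms(2) by simp
  qed
  then show ?thesis
    by (simp add: poly_eq_iff)
qed

lemma antideriv_trunc_eigenvector_at_nodes:
  assumes "inj_on c {..<s}" "degree Q < s" "e \<noteq> 0"
    and "\<And>i. i < s \<Longrightarrow> poly (antideriv_trunc s Q) (c i) = e * poly Q (c i)"
  shows "Q = 0"
proof (rule antideriv_trunc_eigenvector[OF _ assms(3)])
  show "antideriv_trunc s Q = smult e Q"
  proof (rule poly_eqI_degree[where A = "c ` {..<s}"])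
    show "degree (antideriv_trunc s Q) < card (c ` {..<s})"
      using degree_antideriv_trunc[OF assms(2)] assms(1) by (simp add: card_image)
    show "degree (smult e Q) < card (c ` {..<s})"
      using assms(1,2) by (simp add: card_image)
  qed (use assms(4) in auto)
qed

definition colloc_v :: "(nat \<Rightarrow> real) \<Rightarrow> nat \<Rightarrow> nat \<Rightarrow> real" where
  "colloc_v c s j = coeff (antideriv (lagrange_basis c s j)) s"

lemma colloc_A_split:
  "colloc_A c s i j = c i ^ s * colloc_v c s j + poly (antideriv_trunc s (lagrange_basis c s j)) (c i)"
  by (simp add: colloc_A_def colloc_v_def antideriv_trunc_def poly_monom)

lemma colloc_v_nonzero:
  assumes "inj_on c {..<s}" "0 < s"
  shows "\<exists>j<s. colloc_v c s j \<noteq> 0"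
proof (rule ccontr)
  assume "\<not> (\<exists>j<s. colloc_v c s j \<noteq> 0)"
  moreover have "monom 1 (s - 1) = (\<Sum>j<s. smult (c j ^ (s - 1)) (lagrange_basis c s j))"
    using lagrange_interpolation[OF assms(1), of "monom 1 (s - 1)"] assms(2)
    by (simp add: degree_monom_eq poly_monom)
  then have "coeff (antideriv (monom 1 (s - 1))) s = (\<Sum>j<s. c j ^ (s - 1) * colloc_v c s j)"
    by (simp add: antideriv_sum antideriv_smult coeff_sum colloc_v_def)
  ultimately show False
    using assms(2) by (simp add: antideriv_monom)
qed

lemma spectral_radius_zero_antideriv_trunc:
  assumes "inj_on c {..<s}"
  shows "spectral_radius_zero s (\<lambda>i j. poly (antideriv_trunc s (lagrange_basis c s j)) (c i))"
  unfolding spectral_radius_zero_def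
proof (intro allI impI)
  fix e :: complex
  assume "\<exists>v. (\<exists>i<s. v i \<noteq> 0) \<and> (\<forall>i<s. (\<Sum>j<s. complex_of_real (poly (antideriv_trunc s (lagrange_basis c s j)) (c i)) * v j) = e * v i)"
  then obtain v i0 where i0: "i0 < s" "v i0 \<noteq> 0"
    and eigen: "\<And>i. i < s \<Longrightarrow> (\<Sum>j<s. complex_of_real (poly (antideriv_trunc s (lagrange_basis c s j)) (c i)) * v j) = e * v i"
    by blast
  define L where "L j = map_poly complex_of_real (lagrange_basis c s j)" for j
  define Q where "Q = (\<Sum>j<s. smult (v j) (L j))"
  have poly_Q: "poly Q (of_real (c i)) = v i" if "i < s" for i
  proof -
    have "poly Q (of_real (c i)) = (\<Sum>j<s. if i = j then v j else 0)"
      unfolding Q_def L_def poly_sum poly_smult poly_map_poly_of_real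
      using that by (intro sum.cong) (auto simp: poly_lagrange_basis[OF assms])
    then show ?thesis
      using that by simp
  qed
  have "degree (L j) \<le> s - 1" if "j < s" for j
    unfolding L_def using degree_lagrange_basis[OF that, of c] by (subst degree_map_poly) auto
  then have "degree Q \<le> s - 1"
    unfolding Q_def by (intro degree_sum_le) (auto intro: order.trans[OF degree_smult_le])
  then have "degree Q < s"
    using i0(1) by linarith
  show "e = 0"
  proof (rule ccontr)
    assume "e \<noteq> 0"
    have "poly (antideriv_trunc s Q) (of_real (c i)) = e * poly Q (of_real (c i))" if "i < s" for i
      using eigen[OF that] poly_Q[OF that]
      by (simp add: Q_def L_def antideriv_trunc_sum antideriv_trunc_smult antideriv_trunc_map_of_real
          poly_sum poly_map_poly_of_real mult.commute)
    then have "Q = 0"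
      using antideriv_trunc_eigenvector_at_nodes[of "\<lambda>i. of_real (c i)" s Q e] assms \<open>degree Q < s\<close> \<open>e \<noteq> 0\<close>
      by (auto simp: inj_on_def)
    then show False
      using poly_Q[OF i0(1)] i0(2) by simp
  qed
qed

theorem monoimplicit_symplectic_rk_exists:
  assumes "1 \<le> p"
  shows "\<exists>s (A :: nat \<Rightarrow> nat \<Rightarrow> real) b.
          rk_order_ge s A b p \<and>
          (\<exists>R N. rank_one s R \<and> spectral_radius_zero s N \<and> (\<forall>i<s. \<forall>j<s. A i j = R i j + N i j)) \<and>
          (\<forall>i<s. \<forall>j<s. b i * b j - b i * A i j - b j * A j i = 0)"
proof -
  obtain c where inj: "inj_on c {..<p}"
    and c: "\<And>j. j < p \<Longrightarrow> 0 < c j \<and> c j < 1 \<and> poly (rodrigues p p) (c j) = 0"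
    using gauss_nodes assms by (metis less_le_trans zero_less_one)
  have "rk_order_ge p (colloc_A c p) (colloc_b c p) p"
    using colloc_A_powers[OF inj] colloc_b_powers[OF inj] c by (intro rk_order_ge_of_B_C[where c = c]) auto
  moreover have "rank_one p (\<lambda>i j. c i ^ p * colloc_v c p j)"
  proof -
    have "0 < p" "c 0 ^ p \<noteq> 0"
      using assms c[of 0] by auto
    then show ?thesis
      unfolding rank_one_def using colloc_v_nonzero[OF inj]
      by (intro exI[of _ "\<lambda>i. c i ^ p"] exI[of _ "colloc_v c p"] conjI) auto
  qed
  moreover have "\<forall>i<p. \<forall>j<p. colloc_b c p i * colloc_b c p j - colloc_b c p i * colloc_A c p i j
      - colloc_b c p j * colloc_A c p j i = 0"
    using colloc_symplectic[OF inj] c by blast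
  ultimately show ?thesis
    using spectral_radius_zero_antideriv_trunc[OF inj] colloc_A_split by blast
qed

theorem corollary1:
  fixes dummy :: "'d::finite itself"
  shows
  "(\<forall>(H :: real^('d+'d) \<Rightarrow> real) (as :: real list) (h :: real).
      smooth_fun H \<longrightarrow>
      ((\<forall>(C :: real^('d+'d)^('d+'d)) z0 z1.
          first_integral H (\<lambda>z. z \<bullet> (C *v z)) \<and> is_step H as h z0 z1 \<longrightarrow>
          z1 \<bullet> (C *v z1) = z0 \<bullet> (C *v z0))
     \<and> (\<forall>(U :: (real^('d+'d)) set) (\<mu> :: real^('d+'d) \<Rightarrow> real^('d+'d)).
          open U \<and> (\<forall>z\<in>U. \<mu> differentiable (at z) \<and> inN (step_res H as h z (\<mu> z))) \<longrightarrow>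
          (\<forall>z\<in>U. \<exists>\<Phi>'. ((\<lambda>w. projE (step_res H as h w (\<mu> w))) has_derivative \<Phi>') (at z) \<and>
                         (\<forall>u v. omega (\<Phi>' u) (\<Phi>' v) = omega u v)))
     \<and> (\<forall>(A :: real^('d+'d)^('d+'d)) (b :: real^('d+'d)).
          (\<forall>z. XH H (A *v z + b) = A *v XH H z) \<longrightarrow>
          (\<forall>z0 z1. is_step H as h z0 z1 \<longrightarrow> is_step H as h (A *v z0 + b) (A *v z1 + b)))))
   \<and> (\<forall>p::nat. p \<ge> 1 \<longrightarrow>
       (\<exists>(s::nat) (A :: nat \<Rightarrow> nat \<Rightarrow> real) (b :: nat \<Rightarrow> real).
          rk_order_ge s A b p \<and>
          (\<exists>R N. rank_one s R \<and> spectral_radius_zero s N \<and>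
                 (\<forall>i<s. \<forall>j<s. A i j = R i j + N i j)) \<and>
          (\<forall>i<s. \<forall>j<s. b i * b j - b i * A i j - b j * A j i = 0)))"
  apply (intro conjI allI impI ballI)
  subgoal using is_step_quadratic_first_integral by blast
  subgoal for H as h U \<mu> z
    using step_map_symplectic[of H U z \<mu> as h] unfolding preserves_form_def by blast
  subgoal using is_step_affine_equivariant by blast
  subgoal by (rule monoimplicit_symplectic_rk_exists)
  done

end
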